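(* For all $\varepsilon\in\left(0,\frac{1}{9\mathrm{e}}\right)$ and all $d\in\mathbb{N}$, $$\max\left\{\frac{1}{9\varepsilon}\log\left(\frac{1}{9\varepsilon}\right),\ \frac{d}{2\mathrm{e}\,\varepsilon}\right\}\ \leq\ N(\varepsilon,d)\ \leq\ \left\lceil 9\,(1+\mathrm{e}^{-1})\,\frac{d}{\varepsilon}\,\log\left(\frac{9(\mathrm{e}+1)}{\varepsilon}\right)\right\rceil,$$ where $N(\varepsilon,d)$ is the inverse of the expected dispersion of independent uniformly distributed points in $[0,1]^d$.
   Context: $\mathbb{N}=\{1,2,\dots\}$, $\log$ is the natural logarithm and $\mathrm{e}$ is Euler's number. For points $x_1,\dots,x_n\in[0,1]^d$ the dispersion is $$\operatorname{disp}(x_1,\dots,x_n):=\sup_{B\cap\{x_1,\dots,x_n\}=\emptyset}\lambda_d(B),$$ where $\lambda_d$ is the $d$-dimensional Lebesgue measure and the supremum is over all axis-parallel boxes $B=I_1\times\dots\times I_d$ with intervals $I_k\subseteq[0,1]$ that contain none of the points. (The supremum is unchanged if one restricts to half-open boxes with rational endpoints; hence $\operatorname{disp}$ is a measurable function of the points.) Let $(X_i)_{i\in\mathbb{N}}$ be an i.i.d. sequence of random variables uniformly distributed on $[0,1]^d$, defined on a common probability space. For $\varepsilon\in(0,1)$ and $d\in\mathbb{N}$ the inverse of the expected dispersion is $$N(\varepsilon,d):=\min\{n\in\mathbb{N}\mid \mathbb{E}(\operatorname{disp}(X_1,\dots,X_n))\leq\varepsilon\}.$$ *)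

theory Defs
  imports "HOL-Probability.Probability"
begin

(* The dimension d is CARD('d). *)

definition box_in_unit_cube :: "(real ^ 'd) set \<Rightarrow> bool" where
  "box_in_unit_cube B \<longleftrightarrow>
     (\<exists>I :: 'd \<Rightarrow> real set. (\<forall>k. is_interval (I k) \<and> I k \<subseteq> {0..1}) \<and>
        B = {x. \<forall>k. x $ k \<in> I k})"

(* The dispersion depends only on the set P of points, not on their order or multiplicity.
   The intervals may be open, closed, half-open, degenerate or empty; the set of volumes is
   nonempty (take B = {}) and contained in [0,1], so the real supremum is the intended one. *)
definition dispersion :: "(real ^ 'd) set \<Rightarrow> real" where
  "dispersion P = Sup {measure lborel B | B. box_in_unit_cube B \<and> B \<inter> P = {}}"

(* The index set {1..} is the set of natural numbers without 0; X 0 plays no role. *)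
definition iid_uniform_unit_cube :: "'a measure \<Rightarrow> (nat \<Rightarrow> 'a \<Rightarrow> real ^ 'd) \<Rightarrow> bool" where
  "iid_uniform_unit_cube M X \<longleftrightarrow>
     prob_space.indep_vars M (\<lambda>_. borel) X {1..} \<and>
     (\<forall>i\<ge>1. distr M borel (X i) = uniform_measure lborel (cbox 0 1))"

definition expected_dispersion :: "'a measure \<Rightarrow> (nat \<Rightarrow> 'a \<Rightarrow> real ^ 'd) \<Rightarrow> nat \<Rightarrow> real" where
  "expected_dispersion M X n = (\<integral>\<omega>. dispersion ((\<lambda>i. X i \<omega>) ` {1..n}) \<partial>M)"

definition inverse_expected_dispersion ::
    "'a measure \<Rightarrow> (nat \<Rightarrow> 'a \<Rightarrow> real ^ 'd) \<Rightarrow> real \<Rightarrow> nat" where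
  "inverse_expected_dispersion M X \<epsilon> = (LEAST n. n \<ge> 1 \<and> expected_dispersion M X n \<le> \<epsilon>)"

end

theory Submission
  imports Defs
begin

text \<open>
  The inverse of the expected dispersion is bounded through bounds on the expected dispersion
  of \<open>n\<close> points itself. In each of the three bounds, the dispersion is compared pointwise with a
  combination of products \<open>\<Prod>i\<le>n. g (X\<^sub>i)\<close>, whose expectation is the \<open>n\<close>-th power of the integral of
  \<open>g\<close> over the unit cube.

  Upper bound. If there is an empty box of volume more than \<open>t\<close>, then one of finitely many boxes on
  a grid, of volume at least \<open>3 / 4 * t\<close>, is empty too. A union bound estimates the probability of
  this. The point is the number of grid boxes: an argument that counts all pairs of grid
  points gives a power of \<open>d\<close> that is too large. A box of volume more than \<open>t\<close>, however, has
  faces whose distances to those of the cube add up to at most \<open>ln (1 / t)\<close> over all coordinates.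
  Hence only integer vectors with a bounded sum have to be counted, and their number is of the form
  \<open>b ^ (2 * d)\<close> with a base \<open>b\<close> that depends on \<open>t\<close> alone (lemmas
  \<open>gap_box_approximation\<close>, \<open>card_bounded_sum_le\<close> and \<open>expected_dispersion_le_union_bound\<close>).

  Logarithmic lower bound. Among \<open>m\<close> parallel slabs of equal volume, one is empty with probability at
  least 1/2 as long as the number of points is below about \<open>m * ln m\<close>; this is the coupon collector
  problem, treated by the second moment method (\<open>expected_dispersion_ge_empty_slab\<close>).

  Dimensional lower bound. In a box containing about \<open>d\<close> random points, each point can be
  cut off in the coordinate in which it is closest to the lower face. This costs a proportion
  \<open>1 / (d + 1)\<close> of the volume on average, so that \<open>d\<close> cuts leave a proportion of about \<open>exp (- 1)\<close>. A
  slab of volume about \<open>d / n\<close> contains about \<open>d\<close> of \<open>n\<close> points. Since the points outside the slab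
  contribute factors 1 to the product, the number of points inside never has to be discussed
  (\<open>dispersion_ge_prod_slab_depth\<close> and \<open>expected_dispersion_ge_slab_depth\<close>).

  The lower bounds need the dispersion to be measurable, because a Bochner integral of a
  non-measurable function would be 0; this follows from \<open>less_dispersion_iff_gap_box\<close>.
\<close>

section \<open>Volumes of boxes and elementary properties of the dispersion\<close>

lemma lborel_box_cart:
  fixes a b :: "real ^ 'd"
  assumes "\<And>k. a $ k \<le> b $ k"
  shows "emeasure lborel (cbox a b) = ennreal (\<Prod>k\<in>UNIV. b $ k - a $ k)"
    and "measure lborel (cbox a b) = (\<Prod>k\<in>UNIV. b $ k - a $ k)"
    and "measure lborel (box a b) = (\<Prod>k\<in>UNIV. b $ k - a $ k)"
proof -
  have ne: "cbox a b \<noteq> {}"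
    using assms by (auto simp: interval_eq_empty_cart not_less)
  show m: "measure lborel (cbox a b) = (\<Prod>k\<in>UNIV. b $ k - a $ k)"
    using content_cbox_cart[OF ne] by simp
  show "emeasure lborel (cbox a b) = ennreal (\<Prod>k\<in>UNIV. b $ k - a $ k)"
    unfolding m[symmetric]
    by (rule emeasure_eq_ennreal_measure) (use emeasure_lborel_cbox_finite[of a b] in auto)
  have eq: "emeasure lborel (box a b) = emeasure lborel (cbox a b)"
    unfolding emeasure_lborel_box_eq emeasure_lborel_cbox_eq ..
  show "measure lborel (box a b) = (\<Prod>k\<in>UNIV. b $ k - a $ k)"
    using m eq by (simp add: measure_def)
qed

lemma emeasure_unit_cube: "emeasure lborel (cbox 0 1 :: (real ^ 'd) set) = 1"
  using lborel_box_cart(1)[of "0 :: real ^ 'd" 1] by simp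

lemma box_in_unit_cube_subset: "box_in_unit_cube B \<Longrightarrow> B \<subseteq> cbox 0 1"
  unfolding box_in_unit_cube_def by (fastforce simp: mem_box_cart)

lemma box_in_unit_cube_box:
  assumes "\<And>k. 0 \<le> a $ k" "\<And>k. b $ k \<le> 1"
  shows "box_in_unit_cube (box a b :: (real ^ 'd) set)"
  unfolding box_in_unit_cube_def
proof (intro exI conjI allI)
  fix k
  show "is_interval {a $ k<..<b $ k}" by (simp add: is_interval_oo)
  show "{a $ k<..<b $ k} \<subseteq> {0..1}"
    using assms[of k] by (auto intro: order_trans less_imp_le)
  show "box a b = {x. \<forall>k. x $ k \<in> {a $ k<..<b $ k}}"
    by (auto simp: mem_box_cart)
qed

lemma box_in_unit_cube_volume_le_1:
  assumes "box_in_unit_cube (B :: (real ^ 'd) set)"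
  shows "measure lborel B \<le> 1"
proof -
  have "emeasure lborel B \<le> emeasure lborel (cbox 0 1 :: (real ^ 'd) set)"
    using box_in_unit_cube_subset[OF assms] by (intro emeasure_mono) auto
  then show ?thesis
    unfolding emeasure_unit_cube measure_def
    by (metis enn2real_mono enn2real_1 ennreal_one_less_top)
qed

lemma dispersion_ge:
  assumes "box_in_unit_cube B" "B \<inter> P = {}"
  shows "measure lborel B \<le> dispersion P"
  unfolding dispersion_def
  by (rule cSup_upper) (use assms box_in_unit_cube_volume_le_1 in \<open>auto simp: bdd_above_def\<close>)

lemma box_in_unit_cube_empty: "box_in_unit_cube ({} :: (real ^ 'd) set)"
  unfolding box_in_unit_cube_def by (rule exI[of _ "\<lambda>_. {}"]) auto

lemma less_dispersionD:
  assumes "c < dispersion (P :: (real ^ 'd) set)"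
  obtains B where "box_in_unit_cube B" "B \<inter> P = {}" "c < measure lborel B"
proof -
  have "{measure lborel B | B. box_in_unit_cube B \<and> B \<inter> P = {}} \<noteq> {}"
    using box_in_unit_cube_empty by blast
  then show ?thesis
    using assms that unfolding dispersion_def by (auto elim!: less_cSupE)
qed

lemma dispersion_nonneg: "0 \<le> dispersion P"
  using dispersion_ge[OF box_in_unit_cube_empty, of P] by simp

lemma dispersion_le_1: "dispersion P \<le> 1"
  using box_in_unit_cube_volume_le_1 by (meson less_dispersionD not_le)

section \<open>Discretization of boxes\<close>

text \<open>A box is encoded by the $2d$ gaps between its faces and those of the unit cube, measured in
  multiples of \<open>h\<close>; the flag selects the lower (\<open>False\<close>) or upper (\<open>True\<close>) face. Counting from
  both ends avoids any condition that \<open>1 / h\<close> be an integer, and it makes the sum of the gaps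
  small for every box of large volume.\<close>

definition gap_box :: "real \<Rightarrow> ('d \<times> bool \<Rightarrow> nat) \<Rightarrow> (real ^ 'd) set" where
  "gap_box h g = box (\<chi> k. h * real (g (k, False))) (\<chi> k. 1 - h * real (g (k, True)))"

lemma gap_box_in_unit_cube: "0 \<le> h \<Longrightarrow> box_in_unit_cube (gap_box h g)"
  unfolding gap_box_def by (intro box_in_unit_cube_box) auto

lemma borel_gap_box [measurable]: "gap_box h g \<in> sets borel"
  unfolding gap_box_def by simp

lemma volume_gap_box:
  assumes "\<And>k. h * real (g (k, False)) + h * real (g (k, True)) \<le> 1"
  shows "measure lborel (gap_box h g) =
    (\<Prod>k\<in>UNIV. 1 - h * real (g (k, True)) - h * real (g (k, False)))"
  unfolding gap_box_def using assms
  by (subst lborel_box_cart) (auto simp: algebra_simps)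

text \<open>The intervals of a box may contain their end points or not. Passing to infima and suprema
  traps the box between an open and a closed box with the same corners, so that neither
  measurability nor the kind of the intervals matters afterwards.\<close>

lemma box_in_unit_cube_ends:
  assumes "box_in_unit_cube (B :: (real ^ 'd::finite) set)" and "B \<noteq> {}"
  obtains a b :: "'d::finite \<Rightarrow> real" where "\<And>k. 0 \<le> a k" "\<And>k. a k \<le> b k" "\<And>k. b k \<le> 1"
    "box (\<chi> k. a k) (\<chi> k. b k) \<subseteq> B" "measure lborel B \<le> (\<Prod>k\<in>UNIV. b k - a k)"
proof -
  from assms(1) obtain I :: "'d \<Rightarrow> real set"
    where "\<forall>k. is_interval (I k) \<and> I k \<subseteq> {0..1}" and B: "B = {x. \<forall>k. x $ k \<in> I k}"
    unfolding box_in_unit_cube_def by (elim exE conjE) (rule that)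
  then have I: "is_interval (I k)" "I k \<subseteq> {0..1}" for k
    by auto
  obtain x where "x \<in> B" using assms(2) by blast
  then have "x $ k \<in> I k" for k unfolding B by blast
  then have ne: "I k \<noteq> {}" for k by blast
  have bdd: "bdd_below (I k)" "bdd_above (I k)" for k
    using I(2)[of k] by (auto intro: bdd_below_mono bdd_above_mono)
  define a where "a k = Inf (I k)" for k
  define b where "b k = Sup (I k)" for k
  have between: "a k \<le> x" "x \<le> b k" if "x \<in> I k" for k x
    unfolding a_def b_def using bdd that by (auto intro: cInf_lower cSup_upper)
  have 0: "0 \<le> a k" for k
    unfolding a_def using ne I(2)[of k] by (intro cInf_greatest) auto
  have 1: "b k \<le> 1" for k
    unfolding b_def using ne I(2)[of k] by (intro cSup_least) auto
  have le: "a k \<le> b k" for k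
    using ne[of k] between[of _ k] by fastforce
  have inner: "x \<in> I k" if lt: "a k < x" "x < b k" for k x
  proof -
    obtain y where "y \<in> I k" "y < x"
      using cInf_lessD[OF ne lt(1)[unfolded a_def]] by blast
    moreover obtain z where "z \<in> I k" "x < z"
      using less_cSupD[OF ne lt(2)[unfolded b_def]] by blast
    ultimately show ?thesis
      using I(1)[of k] by (meson is_interval_1 less_imp_le)
  qed
  have "emeasure lborel B \<le> emeasure lborel (cbox (\<chi> k. a k) (\<chi> k. b k))"
    by (rule emeasure_mono) (use between in \<open>auto simp: B mem_box_cart\<close>)
  then have "measure lborel B \<le> measure lborel (cbox (\<chi> k. a k) (\<chi> k. b k))"
    unfolding measure_def
    by (intro enn2real_mono) (use emeasure_lborel_cbox_finite in auto)
  also have "\<dots> = (\<Prod>k\<in>UNIV. b k - a k)"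
    using le by (subst lborel_box_cart) auto
  finally show ?thesis
    using 0 1 le inner by (intro that[of a b]) (auto simp: B mem_box_cart)
qed

text \<open>Every gap is rounded up to a multiple of \<open>h\<close>. This shortens each side by at most \<open>2 * h\<close>, and
  since the sides have length at most 1, the volume drops by at most the sum of these losses.
  The exact gaps in one coordinate add up to \<open>1 - l\<close>, where \<open>l\<close> is the side length, and
  \<open>1 - l \<le> - ln l\<close>, so all gaps together are at most the logarithm of the inverse volume.
  This last bound does not grow with the dimension, and it is what keeps the number of relevant
  boxes small.\<close>

lemma gap_box_approximation:
  fixes B :: "(real ^ 'd) set"
  assumes B: "box_in_unit_cube B" and pos: "0 < measure lborel B" and h: "0 < h"
  obtains g :: "'d::finite \<times> bool \<Rightarrow> nat" where "gap_box h g \<subseteq> B"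
    "measure lborel B - 2 * real CARD('d) * h \<le> measure lborel (gap_box h g)"
    "h * real (sum g UNIV) \<le> ln (1 / measure lborel B) + 2 * real CARD('d) * h"
proof -
  have "B \<noteq> {}" using pos by auto
  with B obtain a b :: "'d \<Rightarrow> real" where a: "\<And>k. 0 \<le> a k" and ab: "\<And>k. a k \<le> b k"
    and b: "\<And>k. b k \<le> 1" and sub: "box (\<chi> k. a k) (\<chi> k. b k) \<subseteq> B"
    and vol: "measure lborel B \<le> (\<Prod>k\<in>UNIV. b k - a k)"
    by (rule box_in_unit_cube_ends) blast
  define g :: "'d \<times> bool \<Rightarrow> nat"
    where "g = (\<lambda>(k, s). nat \<lceil>(if s then 1 - b k else a k) / h\<rceil>)"
  have round: "c \<le> h * real (nat \<lceil>c / h\<rceil>)" "h * real (nat \<lceil>c / h\<rceil>) \<le> c + h" if "0 \<le> c" for c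
  proof -
    have "0 \<le> c / h" using that h by simp
    then have "real (nat \<lceil>c / h\<rceil>) = of_int \<lceil>c / h\<rceil>"
      by (simp add: order_trans[OF _ le_of_int_ceiling])
    then have "c / h \<le> real (nat \<lceil>c / h\<rceil>)" "real (nat \<lceil>c / h\<rceil>) \<le> c / h + 1"
      by linarith+
    then show "c \<le> h * real (nat \<lceil>c / h\<rceil>)" "h * real (nat \<lceil>c / h\<rceil>) \<le> c + h"
      using h by (auto simp: field_simps)
  qed
  have g: "g (k, False) = nat \<lceil>a k / h\<rceil>" "g (k, True) = nat \<lceil>(1 - b k) / h\<rceil>" for k
    by (simp_all add: g_def)
  have l: "a k \<le> h * real (g (k, False))" "h * real (g (k, False)) \<le> a k + h" for k
    unfolding g using round[of "a k"] a[of k] by blast+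
  have r: "1 - b k \<le> h * real (g (k, True))" "h * real (g (k, True)) \<le> 1 - b k + h" for k
    unfolding g using round[of "1 - b k"] b[of k] by (smt (verit))+
  define w where "w k = 1 - h * real (g (k, True)) - h * real (g (k, False))" for k
  have w: "w k \<le> b k - a k" "b k - a k - 2 * h \<le> w k" for k
    unfolding w_def using l[of k] r[of k] by linarith+
  have prod_pos: "0 < (\<Prod>k\<in>UNIV. b k - a k)" using pos vol by linarith
  have len: "0 < b k - a k" for k
    using ab[of k] prod_pos by (cases "b k = a k") (auto simp: less_le)
  have len1: "b k - a k \<le> 1" for k using a[of k] b[of k] by linarith
  have sub_gap: "gap_box h g \<subseteq> B"
  proof -
    have "gap_box h g \<subseteq> box (\<chi> k. a k) (\<chi> k. b k)"
    proof
      fix x assume "x \<in> gap_box h g"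
      then have "h * real (g (k, False)) < x $ k" "x $ k < 1 - h * real (g (k, True))" for k
        by (auto simp: gap_box_def mem_box_cart)
      then have "a k < x $ k \<and> x $ k < b k" for k
        using l(1)[of k] r(1)[of k] by (smt (verit))
      then show "x \<in> box (\<chi> k. a k) (\<chi> k. b k)"
        by (simp add: mem_box_cart)
    qed
    then show ?thesis using sub by blast
  qed
  have vol_gap: "measure lborel B - 2 * real CARD('d) * h \<le> measure lborel (gap_box h g)"
  proof (cases "\<forall>k. 0 \<le> w k")
    case True
    have "(\<Prod>k\<in>UNIV. b k - a k) - (\<Prod>k\<in>UNIV. w k) \<le> norm ((\<Prod>k\<in>UNIV. b k - a k) - (\<Prod>k\<in>UNIV. w k))"
      by simp
    also have "\<dots> \<le> (\<Sum>k\<in>UNIV. norm ((b k - a k) - w k))"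
    proof (rule norm_prod_diff)
      fix k :: 'd
      show "norm (b k - a k) \<le> 1" using len[of k] len1[of k] by simp
      show "norm (w k) \<le> 1" using True w(1)[of k] len1[of k] by (simp add: order_trans)
    qed
    also have "\<dots> \<le> (\<Sum>k\<in>(UNIV :: 'd set). 2 * h)"
    proof (rule sum_mono)
      fix k :: 'd
      show "norm ((b k - a k) - w k) \<le> 2 * h" using w[of k] by simp
    qed
    finally have "(\<Prod>k\<in>UNIV. b k - a k) - 2 * real CARD('d) * h \<le> (\<Prod>k\<in>UNIV. w k)" by simp
    moreover have "measure lborel (gap_box h g) = (\<Prod>k\<in>UNIV. w k)"
      unfolding w_def using True by (intro volume_gap_box) (auto simp: w_def algebra_simps)
    ultimately show ?thesis using vol by linarith
  next
    case False
    then obtain k where k: "w k < 0" by (auto simp: not_le)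
    have "(\<Prod>k\<in>UNIV. b k - a k) = (b k - a k) * (\<Prod>k\<in>UNIV - {k}. b k - a k)"
      by (rule prod.remove) auto
    also have "\<dots> \<le> (b k - a k) * 1"
      using len len1 by (intro mult_left_mono prod_le_1) (auto intro: less_imp_le)
    also have "\<dots> \<le> 2 * h" using w(2)[of k] k by simp
    also have "\<dots> \<le> 2 * real CARD('d) * h"
    proof -
      have "1 \<le> real CARD('d)" by (simp add: Suc_leI)
      then show ?thesis using h by simp
    qed
    finally have "measure lborel B - 2 * real CARD('d) * h \<le> 0" using vol by linarith
    then show ?thesis by (rule order_trans) simp
  qed
  have "h * real (sum g UNIV) = (\<Sum>k\<in>UNIV. h * real (g (k, False)) + h * real (g (k, True)))"
  proof -
    have "sum g (UNIV \<times> UNIV) = (\<Sum>k\<in>UNIV. \<Sum>s\<in>UNIV. g (k, s))"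
      by (simp add: sum.cartesian_product)
    then show ?thesis
      by (simp add: UNIV_bool sum_distrib_left distrib_left add.commute flip: UNIV_Times_UNIV)
  qed
  also have "\<dots> \<le> (\<Sum>k\<in>UNIV. - ln (b k - a k) + 2 * h)"
  proof (rule sum_mono)
    fix k
    show "h * real (g (k, False)) + h * real (g (k, True)) \<le> - ln (b k - a k) + 2 * h"
      using l(2)[of k] r(2)[of k] ln_le_minus_one[OF len[of k]] by linarith
  qed
  also have "\<dots> = - ln (\<Prod>k\<in>UNIV. b k - a k) + 2 * real CARD('d) * h"
    using less_imp_neq[OF len] by (subst ln_prod) (auto simp: sum_subtractf)
  also have "- ln (\<Prod>k\<in>UNIV. b k - a k) \<le> ln (1 / measure lborel B)"
    using vol pos prod_pos by (simp add: ln_div)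
  finally show ?thesis
    using sub_gap vol_gap by (intro that[of g]) auto
qed

text \<open>The supremum over all boxes is determined by countably many of them. This makes the dispersion
  of random points measurable.\<close>

lemma less_dispersion_iff_gap_box:
  fixes P :: "(real ^ 'd) set"
  assumes "0 \<le> c"
  shows "c < dispersion P \<longleftrightarrow> (\<exists>m (g :: 'd::finite \<times> bool \<Rightarrow> nat).
    gap_box (1 / real (Suc m)) g \<inter> P = {} \<and> c < measure lborel (gap_box (1 / real (Suc m)) g))"
proof
  assume "c < dispersion P"
  then obtain B where B: "box_in_unit_cube B" "B \<inter> P = {}" "c < measure lborel B"
    by (rule less_dispersionD)
  obtain m :: nat where "2 * real CARD('d) / (measure lborel B - c) < real m"
    using reals_Archimedean2 by blast
  with B(3) have m: "2 * real CARD('d) * (1 / real (Suc m)) < measure lborel B - c"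
    by (simp add: field_simps)
  have "0 < measure lborel B" using assms B(3) by simp
  with B(1) obtain g :: "'d \<times> bool \<Rightarrow> nat" where "gap_box (1 / real (Suc m)) g \<subseteq> B"
    "measure lborel B - 2 * real CARD('d) * (1 / real (Suc m))
       \<le> measure lborel (gap_box (1 / real (Suc m)) g)"
    by (rule gap_box_approximation[where h = "1 / real (Suc m)"]) auto
  with B(2) m show "\<exists>m (g :: 'd \<times> bool \<Rightarrow> nat).
    gap_box (1 / real (Suc m)) g \<inter> P = {} \<and> c < measure lborel (gap_box (1 / real (Suc m)) g)"
    by (intro exI[of _ m] exI[of _ g]) auto
next
  assume "\<exists>m (g :: 'd \<times> bool \<Rightarrow> nat).
    gap_box (1 / real (Suc m)) g \<inter> P = {} \<and> c < measure lborel (gap_box (1 / real (Suc m)) g)"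
  then show "c < dispersion P"
    by (auto simp del: of_nat_Suc intro!: less_le_trans[OF _ dispersion_ge] gap_box_in_unit_cube)
qed

text \<open>The number of vectors of natural numbers with bounded sum, by an exponential weight: each such
  \<open>f\<close> satisfies \<open>1 \<le> exp (K - sum f / \<sigma>)\<close>, where \<open>K\<close> is the number of entries, and the sum of the
  right-hand sides over all vectors is a product of geometric series, each of which is at most
  \<open>\<sigma> + 1\<close>.\<close>

lemma card_bounded_sum_le:
  assumes \<sigma>: "0 < \<sigma>"
  defines "F \<equiv> {f :: 'k::finite \<Rightarrow> nat. real (sum f UNIV) \<le> \<sigma> * real CARD('k)}"
  shows "finite F" and "real (card F) \<le> (exp 1 * (\<sigma> + 1)) ^ CARD('k)"
proof -
  define N where "N = nat \<lfloor>\<sigma> * real CARD('k)\<rfloor>"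
  define A where "A = PiE (UNIV :: 'k set) (\<lambda>_. {..N})"
  have finA: "finite A" unfolding A_def by (intro finite_PiE) auto
  have FA: "F \<subseteq> A"
  proof
    fix f assume "f \<in> F"
    then have "sum f UNIV \<le> N" unfolding F_def N_def by (simp add: le_nat_floor)
    moreover have "f k \<le> sum f UNIV" for k by (rule member_le_sum) auto
    ultimately show "f \<in> A" unfolding A_def by (auto intro: order_trans)
  qed
  then show "finite F" using finA finite_subset by blast
  define q where "q = exp (- (1 / \<sigma>))"
  have q: "0 < q" "q < 1" unfolding q_def using \<sigma> by auto
  have "real (card F) = (\<Sum>f\<in>F. 1)" by simp
  also have "\<dots> \<le> (\<Sum>f\<in>F. exp (real CARD('k)) * (\<Prod>k\<in>UNIV. q ^ f k))"
  proof (rule sum_mono)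
    fix f assume "f \<in> F"
    then have "real (sum f UNIV) / \<sigma> \<le> real CARD('k)"
      using \<sigma> by (simp add: F_def field_simps)
    then have "1 \<le> exp (real CARD('k) + real (sum f UNIV) * (- (1 / \<sigma>)))" by simp
    also have "\<dots> = exp (real CARD('k)) * q ^ sum f UNIV"
      unfolding exp_add exp_of_nat_mult q_def ..
    finally show "1 \<le> exp (real CARD('k)) * (\<Prod>k\<in>UNIV. q ^ f k)" by (simp add: power_sum)
  qed
  also have "\<dots> \<le> (\<Sum>f\<in>A. exp (real CARD('k)) * (\<Prod>k\<in>UNIV. q ^ f k))"
    using FA finA q by (intro sum_mono2) (auto intro!: mult_nonneg_nonneg prod_nonneg)
  also have "\<dots> = exp (real CARD('k)) * (\<Prod>k\<in>(UNIV :: 'k set). \<Sum>j\<le>N. q ^ j)"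
    unfolding A_def by (subst prod_sum_PiE) (auto simp: sum_distrib_left)
  also have "\<dots> = (exp 1 * (\<Sum>j\<le>N. q ^ j)) ^ CARD('k)"
    using exp_of_nat_mult[of "CARD('k)" "1 :: real"] by (simp add: power_mult_distrib)
  also have "\<dots> \<le> (exp 1 * (\<sigma> + 1)) ^ CARD('k)"
  proof (intro power_mono mult_left_mono)
    have "1 + 1 / \<sigma> \<le> exp (1 / \<sigma>)" by (rule exp_ge_add_one_self)
    moreover have "q * exp (1 / \<sigma>) = 1" unfolding q_def by (simp flip: exp_add)
    ultimately have "q * (1 + 1 / \<sigma>) \<le> 1" using q(1) by (metis mult_left_mono less_imp_le)
    then have "1 \<le> (1 - q) * (\<sigma> + 1)" using \<sigma> by (simp add: field_simps)
    have "(\<Sum>j\<le>N. q ^ j) = (1 - q ^ Suc N) / (1 - q)"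
      using q by (simp add: sum_gp0)
    also have "\<dots> \<le> 1 / (1 - q)" using q by (intro divide_right_mono) auto
    also have "\<dots> \<le> \<sigma> + 1" using \<open>1 \<le> (1 - q) * (\<sigma> + 1)\<close> q by (simp add: field_simps)
    finally show "(\<Sum>j\<le>N. q ^ j) \<le> \<sigma> + 1" .
  qed (use q in \<open>auto intro!: mult_nonneg_nonneg sum_nonneg\<close>)
  finally show "real (card F) \<le> (exp 1 * (\<sigma> + 1)) ^ CARD('k)" .
qed

text \<open>The inverse form of \<open>1 + x \<le> exp x\<close> at \<open>x = 1 / (z - 1)\<close>. It bounds powers of \<open>1 - 1 / z\<close> from below
  in both lower bounds on the expected dispersion.\<close>

lemma exp_minus_le_one_minus_inverse:
  fixes z :: real
  assumes "1 < z"
  shows "exp (- (1 / (z - 1))) \<le> 1 - 1 / z"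
proof -
  have "1 + 1 / (z - 1) \<le> exp (1 / (z - 1))" by (rule exp_ge_add_one_self)
  moreover have "1 + 1 / (z - 1) = z / (z - 1)" using assms by (simp add: field_simps)
  ultimately have "inverse (exp (1 / (z - 1))) \<le> inverse (z / (z - 1))"
    using assms by (intro le_imp_inverse_le) auto
  then show ?thesis using assms by (simp add: exp_minus field_simps)
qed

section \<open>Independent uniformly distributed points\<close>

locale uniform_points = prob_space M for M :: "'a measure" +
  fixes X :: "nat \<Rightarrow> 'a \<Rightarrow> real ^ 'd"
  assumes iid: "iid_uniform_unit_cube M X"
begin

abbreviation U :: "(real ^ 'd) measure" where
  "U \<equiv> uniform_measure lborel (cbox 0 1)"

abbreviation disp :: "nat \<Rightarrow> 'a \<Rightarrow> real" where
  "disp n \<omega> \<equiv> dispersion ((\<lambda>i. X i \<omega>) ` {1..n})"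

text \<open>The indicator of the event that no point lies in \<open>A\<close>, in the form of a product over the points, to
  which independence applies directly.\<close>

abbreviation avoids :: "nat \<Rightarrow> (real ^ 'd) set \<Rightarrow> 'a \<Rightarrow> real" where
  "avoids n A \<omega> \<equiv> (\<Prod>i=1..n. indicator (- A) (X i \<omega>))"

lemma prob_space_U: "prob_space U"
  by (rule prob_space_uniform_measure) (auto simp: emeasure_unit_cube)

lemma indep: "indep_vars (\<lambda>_. borel) X {1..}"
  using iid by (simp add: iid_uniform_unit_cube_def)

lemma distr_X: "1 \<le> i \<Longrightarrow> distr M borel (X i) = U"
  using iid by (simp add: iid_uniform_unit_cube_def)

lemma measurable_X [measurable (raw)]: "1 \<le> i \<Longrightarrow> X i \<in> borel_measurable M"
  using indep by (auto simp: indep_vars_def)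

text \<open>All expectations below come from this identity, applied to random variables that are products of
  one and the same function of the individual points.\<close>

lemma
  fixes g :: "real ^ 'd \<Rightarrow> real"
  assumes g [measurable]: "g \<in> borel_measurable borel" and range: "\<And>x. 0 \<le> g x" "\<And>x. g x \<le> 1"
  shows expectation_prod_points: "expectation (\<lambda>\<omega>. \<Prod>i=1..n. g (X i \<omega>)) = (\<integral>x. g x \<partial>U) ^ n"
    and integrable_prod_points: "integrable M (\<lambda>\<omega>. \<Prod>i=1..n. g (X i \<omega>))"
proof -
  have ind: "indep_vars (\<lambda>_. borel) (\<lambda>i \<omega>. g (X i \<omega>)) {1..n}"
    by (rule indep_vars_compose2[OF indep_vars_subset[OF indep]]) auto
  have int: "integrable M (\<lambda>\<omega>. g (X i \<omega>))" if "i \<in> {1..n}" for i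
  proof -
    have [measurable]: "X i \<in> borel_measurable M" using that by (intro measurable_X) auto
    show ?thesis by (rule integrable_const_bound[where B = 1]) (use range in auto)
  qed
  have E: "expectation (\<lambda>\<omega>. g (X i \<omega>)) = (\<integral>x. g x \<partial>U)" if "i \<in> {1..n}" for i
  proof -
    have i: "1 \<le> i" using that by simp
    show ?thesis
      unfolding distr_X[OF i, symmetric] by (rule integral_distr[symmetric]) (use i in measurable)
  qed
  have "expectation (\<lambda>\<omega>. \<Prod>i\<in>{1..n}. g (X i \<omega>)) = (\<Prod>i\<in>{1..n}. expectation (\<lambda>\<omega>. g (X i \<omega>)))"
    by (rule indep_vars_lebesgue_integral) (use ind int in auto)
  also have "\<dots> = (\<Prod>i\<in>{1..n}. \<integral>x. g x \<partial>U)"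
    by (rule prod.cong) (use E in auto)
  finally show "expectation (\<lambda>\<omega>. \<Prod>i=1..n. g (X i \<omega>)) = (\<integral>x. g x \<partial>U) ^ n" by simp
  show "integrable M (\<lambda>\<omega>. \<Prod>i=1..n. g (X i \<omega>))"
    by (rule indep_vars_integrable) (use ind int in auto)
qed

lemma avoids_eq: "avoids n A \<omega> = (if A \<inter> (\<lambda>i. X i \<omega>) ` {1..n} = {} then 1 else 0)"
proof (cases "A \<inter> (\<lambda>i. X i \<omega>) ` {1..n} = {}")
  case True
  then have "indicator (- A) (X i \<omega>) = (1 :: real)" if "i \<in> {1..n}" for i
    using that by (auto simp: indicator_def)
  with True show ?thesis by simp
next
  case False
  then show ?thesis by (auto simp: indicator_def)
qed

lemma
  assumes A [measurable]: "A \<in> sets borel" and sub: "A \<subseteq> cbox 0 1"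
  shows expectation_avoids: "expectation (avoids n A) = (1 - measure lborel A) ^ n"
    and integrable_avoids: "integrable M (avoids n A)"
proof -
  interpret U: prob_space U by (rule prob_space_U)
  have "(\<integral>x. indicator (- A) x \<partial>U) = measure U (- A)" by simp
  also have "\<dots> = measure U (space U - A)" by (simp add: Compl_eq_Diff_UNIV)
  also have "\<dots> = 1 - measure U A" by (rule U.prob_compl) simp
  also have "measure U A = measure lborel A"
    using sub by (subst measure_uniform_measure)
      (auto simp: emeasure_unit_cube measure_def Int_absorb1)
  finally have "(\<integral>x. indicator (- A) x \<partial>U) = 1 - measure lborel A" .
  then show "expectation (avoids n A) = (1 - measure lborel A) ^ n"
    using expectation_prod_points[of "indicator (- A)" n] by simp
  show "integrable M (avoids n A)"
    by (rule integrable_prod_points) (auto simp: indicator_def)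
qed

lemma measurable_disp [measurable]: "disp n \<in> borel_measurable M"
proof (subst borel_measurable_iff_greater, intro allI)
  fix c
  show "{\<omega> \<in> space M. c < disp n \<omega>} \<in> sets M"
  proof (cases "0 \<le> c")
    case True
    have X: "Measurable.pred M (\<lambda>\<omega>. X i \<omega> \<notin> A)" if "i \<in> {1..n}" "A \<in> sets borel" for i A
    proof -
      have [measurable]: "X i \<in> borel_measurable M" "A \<in> sets borel"
        using that by (auto intro: measurable_X)
      show ?thesis by measurable
    qed
    have pred_avoid: "Measurable.pred M (\<lambda>\<omega>. (\<forall>i\<in>{1..n}. X i \<omega> \<notin> A) \<and> c < measure lborel A)"
      if "A \<in> sets borel" for A
    proof -
      have "Measurable.pred M (\<lambda>\<omega>. \<forall>i\<in>{1..n}. X i \<omega> \<notin> A)"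
        using that by (intro pred_intros_finite X) auto
      then show ?thesis by simp
    qed
    have "Measurable.pred M (\<lambda>\<omega>. \<exists>m (g :: 'd \<times> bool \<Rightarrow> nat).
        (\<forall>i\<in>{1..n}. X i \<omega> \<notin> gap_box (1 / real (Suc m)) g) \<and>
        c < measure lborel (gap_box (1 / real (Suc m)) g))"
      by (intro pred_intros_countable(2) pred_avoid borel_gap_box)
    then have "{\<omega> \<in> space M. \<exists>m (g :: 'd \<times> bool \<Rightarrow> nat).
        (\<forall>i\<in>{1..n}. X i \<omega> \<notin> gap_box (1 / real (Suc m)) g) \<and>
        c < measure lborel (gap_box (1 / real (Suc m)) g)} \<in> sets M"
      by (simp add: pred_def)
    also have "{\<omega> \<in> space M. \<exists>m (g :: 'd \<times> bool \<Rightarrow> nat).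
        (\<forall>i\<in>{1..n}. X i \<omega> \<notin> gap_box (1 / real (Suc m)) g) \<and>
        c < measure lborel (gap_box (1 / real (Suc m)) g)} = {\<omega> \<in> space M. c < disp n \<omega>}"
      unfolding less_dispersion_iff_gap_box[OF True] by blast
    finally show ?thesis .
  next
    case False
    then have "c < disp n \<omega>" for \<omega>
      using dispersion_nonneg[of "(\<lambda>i. X i \<omega>) ` {1..n}"] by linarith
    then show ?thesis by simp
  qed
qed

lemma integrable_disp: "integrable M (disp n)"
  by (rule integrable_const_bound[where B = 1])
    (simp_all add: dispersion_nonneg dispersion_le_1 measurable_disp del: One_nat_def)

section \<open>An upper bound for the expected dispersion\<close>

text \<open>An empty box of volume more than \<open>t\<close> contains a discretized box of volume at least \<open>3 / 4 * t\<close>, which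
  is empty as well. As the dispersion is at most 1, it therefore exceeds \<open>t\<close> by no more than the
  number of empty boxes in the discretization, and each of these is empty with probability at most
  \<open>(1 - 3 / 4 * t) ^ n\<close>.\<close>

lemma expected_dispersion_le_union_bound:
  assumes t: "0 < t" "t < 1"
  shows "expected_dispersion M X n \<le>
    t + (exp 1 * (4 * ln (1 / t) / t + 2)) ^ (2 * CARD('d)) * exp (- (3 / 4 * t * real n))"
proof -
  define d where "d = real CARD('d)"
  have d: "1 \<le> d" by (simp add: d_def Suc_leI)
  define u where "u = ln (1 / t)"
  have u: "0 < u" unfolding u_def using t by simp
  \<comment> \<open>This mesh makes the loss of volume \<open>2 * d * h\<close> a quarter of \<open>t\<close>.\<close>
  define h where "h = t / (8 * d)"
  have h: "0 < h" "2 * d * h = t / 4" unfolding h_def using t d by (auto simp: field_simps)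
  \<comment> \<open>The gaps of a relevant box sum to at most \<open>(u + 2 * d * h) / h\<close>, which is \<open>\<sigma>\<close> per face.\<close>
  define \<sigma> where "\<sigma> = 4 * u / t + 1"
  have \<sigma>: "0 < \<sigma>" unfolding \<sigma>_def using u t by (simp add: add_pos_pos)
  have \<sigma>_h: "h * (\<sigma> * (2 * d)) = u + t / 4"
    unfolding \<sigma>_def h_def using t d by (simp add: field_simps)
  have card_sides: "CARD('d \<times> bool) = 2 * CARD('d)" by simp
  define F where "F = {g :: 'd \<times> bool \<Rightarrow> nat. real (sum g UNIV) \<le> \<sigma> * real CARD('d \<times> bool)}"
  have F: "finite F" "real (card F) \<le> (exp 1 * (\<sigma> + 1)) ^ (2 * CARD('d))"
    using card_bounded_sum_le[OF \<sigma>, where 'k = "'d \<times> bool"] unfolding F_def card_sides by auto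
  define G where "G = {g \<in> F. 3 / 4 * t \<le> measure lborel (gap_box h g)}"
  have G: "finite G" "card G \<le> card F"
    unfolding G_def using F(1) by (auto intro: card_mono)
  have pointwise: "disp n \<omega> \<le> t + (\<Sum>g\<in>G. avoids n (gap_box h g) \<omega>)" for \<omega>
  proof (cases "disp n \<omega> \<le> t")
    case True
    moreover have "0 \<le> (\<Sum>g\<in>G. avoids n (gap_box h g) \<omega>)"
      by (intro sum_nonneg prod_nonneg) auto
    ultimately show ?thesis by linarith
  next
    case False
    then obtain B where B: "box_in_unit_cube B" "B \<inter> (\<lambda>i. X i \<omega>) ` {1..n} = {}"
      and vol: "t < measure lborel B"
      by (auto simp: not_le elim: less_dispersionD)
    have pos: "0 < measure lborel B" using t vol by linarith
    obtain g :: "'d \<times> bool \<Rightarrow> nat" where g: "gap_box h g \<subseteq> B"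
      "measure lborel B - 2 * d * h \<le> measure lborel (gap_box h g)"
      "h * real (sum g UNIV) \<le> ln (1 / measure lborel B) + 2 * d * h"
      using gap_box_approximation[OF B(1) pos h(1)] unfolding d_def by blast
    have "ln (1 / measure lborel B) \<le> u"
      unfolding u_def using vol t pos by (simp add: ln_div)
    then have "h * real (sum g UNIV) \<le> h * (\<sigma> * (2 * d))"
      using g(3) h(2) \<sigma>_h by linarith
    then have "real (sum g UNIV) \<le> \<sigma> * real CARD('d \<times> bool)"
      using h(1) by (simp add: card_sides d_def)
    moreover have "3 / 4 * t \<le> measure lborel (gap_box h g)"
      using g(2) h(2) vol by linarith
    ultimately have gG: "g \<in> G" unfolding G_def F_def by blast
    have "1 = avoids n (gap_box h g) \<omega>"
      unfolding avoids_eq using g(1) B(2) by (simp add: disjoint_iff subset_iff)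
    also have "\<dots> \<le> (\<Sum>g\<in>G. avoids n (gap_box h g) \<omega>)"
      using gG G(1) by (intro member_le_sum prod_nonneg) auto
    finally show ?thesis using dispersion_le_1[of "(\<lambda>i. X i \<omega>) ` {1..n}"] t by linarith
  qed
  have sub: "gap_box h g \<subseteq> cbox 0 1" for g :: "'d \<times> bool \<Rightarrow> nat"
    using h(1) by (intro box_in_unit_cube_subset gap_box_in_unit_cube) auto
  note int = integrable_avoids[OF borel_gap_box sub]
  have "expected_dispersion M X n = expectation (disp n)"
    by (simp add: expected_dispersion_def)
  also have "\<dots> \<le> expectation (\<lambda>\<omega>. t + (\<Sum>g\<in>G. avoids n (gap_box h g) \<omega>))"
    using pointwise int by (intro integral_mono integrable_disp) auto
  also have "\<dots> = t + (\<Sum>g\<in>G. expectation (avoids n (gap_box h g)))"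
    using int by (simp add: prob_space Bochner_Integration.integral_sum)
  also have "\<dots> = t + (\<Sum>g\<in>G. (1 - measure lborel (gap_box h g)) ^ n)"
    by (simp only: expectation_avoids[OF borel_gap_box sub])
  also have "\<dots> \<le> t + (\<Sum>g\<in>G. exp (- (3 / 4 * t * real n)))"
  proof (intro add_left_mono sum_mono)
    fix g assume "g \<in> G"
    then have v: "3 / 4 * t \<le> measure lborel (gap_box h g)" by (simp add: G_def)
    have "measure lborel (gap_box h g) \<le> 1"
      using h(1) by (intro box_in_unit_cube_volume_le_1 gap_box_in_unit_cube) auto
    moreover have "1 + - (3 / 4 * t) \<le> exp (- (3 / 4 * t))" by (rule exp_ge_add_one_self)
    ultimately have "(1 - measure lborel (gap_box h g)) ^ n \<le> exp (- (3 / 4 * t)) ^ n"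
      using v by (intro power_mono) linarith+
    also have "\<dots> = exp (real n * - (3 / 4 * t))" by (rule exp_of_nat_mult[symmetric])
    finally show "(1 - measure lborel (gap_box h g)) ^ n \<le> exp (- (3 / 4 * t * real n))"
      by (simp add: mult.commute)
  qed
  also have "\<dots> = t + real (card G) * exp (- (3 / 4 * t * real n))" by simp
  also have "\<dots> \<le> t + (exp 1 * (\<sigma> + 1)) ^ (2 * CARD('d)) * exp (- (3 / 4 * t * real n))"
    using G(2) F(2) by (intro add_left_mono mult_right_mono) auto
  also have "\<sigma> + 1 = 4 * ln (1 / t) / t + 2" by (simp add: \<sigma>_def u_def)
  finally show ?thesis .
qed

section \<open>Empty slabs: the logarithmic lower bound\<close>

text \<open>The cube is cut into \<open>m\<close> slabs of volume \<open>1 / m\<close>, as in the coupon collector problem, and \<open>Z\<close> counts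
  the empty ones; \<open>x\<close> is its expectation. Two slabs are empty almost independently, with a negative
  correlation, so the second moment of \<open>Z\<close> is at most \<open>x + x\<^sup>2\<close>. The pointwise inequality
  \<open>2 * c * Z - (c * Z)\<^sup>2 \<le> 1\<close>, whose left-hand side vanishes for \<open>Z = 0\<close>, turns the two moments into a
  lower bound for the probability of \<open>Z > 0\<close>.\<close>

lemma expected_dispersion_ge_empty_slab:
  fixes m n :: nat
  assumes m: "2 \<le> m"
  defines "x \<equiv> real m * (1 - 1 / real m) ^ n"
  shows "x / (1 + x) / real m \<le> expected_dispersion M X n"
proof -
  fix k\<^sub>0 :: 'd
  define A :: "nat \<Rightarrow> (real ^ 'd) set" where
    "A j = box (\<chi> k. if k = k\<^sub>0 then real j / real m else 0)
               (\<chi> k. if k = k\<^sub>0 then real (Suc j) / real m else 1)" for j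
  have box: "box_in_unit_cube (A j)" if "j < m" for j
    unfolding A_def using that m by (intro box_in_unit_cube_box) (auto simp: field_simps)
  have vol: "measure lborel (A j) = 1 / real m" for j
  proof -
    have "measure lborel (A j) = (\<Prod>k\<in>(UNIV :: 'd set).
        (if k = k\<^sub>0 then real (Suc j) / real m else 1) - (if k = k\<^sub>0 then real j / real m else 0))"
      unfolding A_def by (subst lborel_box_cart) (auto simp: divide_right_mono)
    also have "\<dots> = (\<Prod>k\<in>(UNIV :: 'd set). if k = k\<^sub>0 then 1 / real m else 1)"
      by (rule prod.cong) (auto simp flip: diff_divide_distrib)
    finally show ?thesis by simp
  qed
  have borel [measurable]: "A j \<in> sets borel" for j unfolding A_def by simp
  have sub: "A j \<subseteq> cbox 0 1" if "j < m" for j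
    using box[OF that] by (rule box_in_unit_cube_subset)
  have disjoint: "A i \<inter> A j = {}" if "i \<noteq> j" for i j
  proof -
    have "A i \<inter> A j = {}" if "i < j" for i j
    proof -
      have "real (Suc i) / real m \<le> real j / real m"
        using that m by (intro divide_right_mono) auto
      moreover have "y $ k\<^sub>0 < real (Suc i) / real m" if "y \<in> A i" for y
        using that by (auto simp: A_def mem_box_cart dest!: spec[of _ k\<^sub>0])
      moreover have "real j / real m < y $ k\<^sub>0" if "y \<in> A j" for y
        using that by (auto simp: A_def mem_box_cart dest!: spec[of _ k\<^sub>0])
      ultimately show ?thesis by fastforce
    qed
    from this[of i j] this[of j i] that show ?thesis by (auto simp: neq_iff)
  qed
  define Z where "Z \<omega> = (\<Sum>j<m. avoids n (A j) \<omega>)" for \<omega>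
  have avoids_Un: "avoids n (A i) \<omega> * avoids n (A j) \<omega> = avoids n (A i \<union> A j) \<omega>" for i j \<omega>
    unfolding avoids_eq by auto
  have Z_sq: "(Z \<omega>)\<^sup>2 = (\<Sum>i<m. \<Sum>j<m. avoids n (A i \<union> A j) \<omega>)" for \<omega>
    unfolding Z_def power2_eq_square sum_product avoids_Un ..
  have int1: "integrable M (avoids n (A j))" if "j < m" for j
    using sub[OF that] by (rule integrable_avoids[OF borel])
  have int2: "integrable M (avoids n (A i \<union> A j))" if "i < m" "j < m" for i j
    using that sub by (intro integrable_avoids) auto
  have int_Z: "integrable M Z"
    unfolding Z_def by (intro Bochner_Integration.integrable_sum int1) auto
  have int_Z_sq: "integrable M (\<lambda>\<omega>. (Z \<omega>)\<^sup>2)"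
    unfolding Z_sq by (intro Bochner_Integration.integrable_sum int2) auto
  have EZ: "expectation Z = x"
  proof -
    have "expectation Z = (\<Sum>j<m. expectation (avoids n (A j)))"
      unfolding Z_def by (rule Bochner_Integration.integral_sum) (use int1 in auto)
    also have "\<dots> = (\<Sum>j<m. (1 - 1 / real m) ^ n)"
      by (intro sum.cong refl) (simp only: expectation_avoids[OF borel sub] vol lessThan_iff)
    finally show ?thesis by (simp add: x_def)
  qed
  have EZ_sq: "expectation (\<lambda>\<omega>. (Z \<omega>)\<^sup>2) \<le> x + x\<^sup>2"
  proof -
    have E: "expectation (avoids n (A i \<union> A j)) \<le>
        (if i = j then (1 - 1 / real m) ^ n else 0) + ((1 - 1 / real m) ^ n)\<^sup>2"
      if ij: "i < m" "j < m" for i j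
    proof (cases "i = j")
      case True
      then show ?thesis
        using expectation_avoids[OF borel sub[OF ij(1)], of n] by (simp add: vol)
    next
      case False
      have "emeasure lborel (A l) \<noteq> \<infinity>" for l
        unfolding A_def using emeasure_lborel_box_finite by (metis less_irrefl)
      then have "measure lborel (A i \<union> A j) = measure lborel (A i) + measure lborel (A j)"
        using disjoint[OF False] by (intro measure_Union) auto
      also have "\<dots> = 2 / real m" by (simp add: vol)
      finally have "expectation (avoids n (A i \<union> A j)) = (1 - 2 / real m) ^ n"
        using ij sub by (subst expectation_avoids) auto
      also have "\<dots> \<le> ((1 - 1 / real m)\<^sup>2) ^ n"
        using m by (intro power_mono) (auto simp: power2_eq_square field_simps)
      also have "\<dots> = ((1 - 1 / real m) ^ n)\<^sup>2" by (simp add: mult.commute flip: power_mult)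
      finally show ?thesis using False by simp
    qed
    have "expectation (\<lambda>\<omega>. (Z \<omega>)\<^sup>2) = (\<Sum>i<m. \<Sum>j<m. expectation (avoids n (A i \<union> A j)))"
      unfolding Z_sq using int2
      by (subst Bochner_Integration.integral_sum)
        (auto intro!: Bochner_Integration.integrable_sum sum.cong Bochner_Integration.integral_sum
          simp del: One_nat_def)
    also have "\<dots> \<le> (\<Sum>i<m. \<Sum>j<m. (if i = j then (1 - 1 / real m) ^ n else 0) + ((1 - 1 / real m) ^ n)\<^sup>2)"
      by (intro sum_mono E) auto
    also have "\<dots> = x + x\<^sup>2"
      by (simp add: sum.distrib x_def power_mult_distrib) (simp add: power2_eq_square algebra_simps)
    finally show ?thesis .
  qed
  have x: "0 < x" unfolding x_def using m by auto
  \<comment> \<open>The maximizer of \<open>2 * c * x - c\<^sup>2 * (x + x\<^sup>2)\<close>.\<close>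
  define c where "c = 1 / (1 + x)"
  have c: "0 < c" unfolding c_def using x by simp
  have pointwise: "(2 * c * Z \<omega> - c\<^sup>2 * (Z \<omega>)\<^sup>2) / real m \<le> disp n \<omega>" for \<omega>
  proof (cases "\<exists>j<m. A j \<inter> (\<lambda>i. X i \<omega>) ` {1..n} = {}")
    case True
    then obtain j where j: "j < m" "A j \<inter> (\<lambda>i. X i \<omega>) ` {1..n} = {}" by blast
    have "2 * c * Z \<omega> - c\<^sup>2 * (Z \<omega>)\<^sup>2 \<le> 1"
      using zero_le_power2[of "1 - c * Z \<omega>"] by (simp add: power2_eq_square algebra_simps)
    then have "(2 * c * Z \<omega> - c\<^sup>2 * (Z \<omega>)\<^sup>2) / real m \<le> 1 / real m"
      by (rule divide_right_mono) simp
    also have "\<dots> \<le> disp n \<omega>" using dispersion_ge[OF box[OF j(1)] j(2)] by (simp only: vol)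
    finally show ?thesis .
  next
    case False
    then have "Z \<omega> = 0" unfolding Z_def avoids_eq by (intro sum.neutral) auto
    then show ?thesis by (simp add: dispersion_nonneg)
  qed
  have "x / (1 + x) = 2 * c * x - c\<^sup>2 * (x + x\<^sup>2)"
    unfolding c_def using x by (simp add: power2_eq_square divide_simps) (simp add: algebra_simps)
  also have "\<dots> \<le> 2 * c * expectation Z - c\<^sup>2 * expectation (\<lambda>\<omega>. (Z \<omega>)\<^sup>2)"
    unfolding EZ using EZ_sq by (intro diff_left_mono mult_left_mono) auto
  finally have "x / (1 + x) / real m \<le>
      (2 * c * expectation Z - c\<^sup>2 * expectation (\<lambda>\<omega>. (Z \<omega>)\<^sup>2)) / real m"
    by (rule divide_right_mono) simp
  also have "\<dots> = expectation (\<lambda>\<omega>. (2 * c * Z \<omega> - c\<^sup>2 * (Z \<omega>)\<^sup>2) / real m)"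
    using int_Z int_Z_sq by simp
  also have "\<dots> \<le> expectation (disp n)"
    using int_Z int_Z_sq pointwise by (intro integral_mono integrable_disp) auto
  finally show ?thesis by (simp only: expected_dispersion_def)
qed

end

section \<open>Cutting away one point per coordinate: the dimensional lower bound\<close>

text \<open>The upper corner of the slab of width \<open>s\<close> in direction \<open>k\<^sub>0\<close>, whose lower corner is the origin.\<close>

definition slab_corner :: "'d \<Rightarrow> real \<Rightarrow> real ^ 'd" where
  "slab_corner k\<^sub>0 s = (\<chi> k. if k = k\<^sub>0 then s else 1)"

text \<open>The least proportion of the slab that has to be cut off at some lower face in order to remove the
  point \<open>x\<close>. For a point outside the slab nothing has to be cut, which explains the value 0.\<close>

definition slab_depth :: "'d \<Rightarrow> real \<Rightarrow> real ^ 'd \<Rightarrow> real" where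
  "slab_depth k\<^sub>0 s x =
    (if x \<in> cbox 0 (slab_corner k\<^sub>0 s) then Min (range (\<lambda>k. x $ k / slab_corner k\<^sub>0 s $ k)) else 0)"

lemma slab_corner_bounds:
  assumes "0 < s" "s \<le> 1"
  shows "0 < slab_corner k\<^sub>0 s $ k" "slab_corner k\<^sub>0 s $ k \<le> 1"
  using assms by (auto simp: slab_corner_def)

lemma prod_slab_corner: "(\<Prod>k\<in>UNIV. slab_corner k\<^sub>0 s $ k) = s"
  by (simp add: slab_corner_def)

lemma measurable_slab_depth [measurable]: "slab_depth k\<^sub>0 s \<in> borel_measurable borel"
proof -
  have [measurable]: "(\<lambda>x. Min ((\<lambda>k. x $ k / slab_corner k\<^sub>0 s $ k) ` UNIV)) \<in> borel_measurable borel"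
    by (rule borel_measurable_Min) auto
  show ?thesis unfolding slab_depth_def by measurable
qed

lemma slab_depth_range:
  assumes "0 < s" "s \<le> 1"
  shows "0 \<le> slab_depth k\<^sub>0 s x" "slab_depth k\<^sub>0 s x \<le> 1"
proof -
  have "0 \<le> x $ k / slab_corner k\<^sub>0 s $ k" "x $ k / slab_corner k\<^sub>0 s $ k \<le> 1" if "x \<in> cbox 0 (slab_corner k\<^sub>0 s)" for k
    using that slab_corner_bounds(1)[OF assms, of k\<^sub>0 k] by (auto simp: mem_box_cart)
  then show "0 \<le> slab_depth k\<^sub>0 s x" "slab_depth k\<^sub>0 s x \<le> 1"
    by (auto simp: slab_depth_def Min_le_iff)
qed

text \<open>Each point of the slab is removed by a cut orthogonal to the coordinate in which this is cheapest.
  If several points are removed through the same coordinate, only the deepest cut counts, and the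
  remaining proportion is at least the product of the proportions for the single cuts. Hence the
  remaining box, which is empty, keeps at least the product over all points.\<close>

lemma dispersion_ge_prod_slab_depth:
  fixes p :: "'i \<Rightarrow> real ^ 'd"
  assumes J: "finite J" and s: "0 < s" "s \<le> 1"
  shows "s * (\<Prod>i\<in>J. 1 - slab_depth k\<^sub>0 s (p i)) \<le> dispersion (p ` J)"
proof -
  define \<sigma> where "\<sigma> k = slab_corner k\<^sub>0 s $ k" for k
  have \<sigma>: "0 < \<sigma> k" "\<sigma> k \<le> 1" for k unfolding \<sigma>_def using slab_corner_bounds[OF s] by auto
  define r where "r i = slab_depth k\<^sub>0 s (p i)" for i
  have r: "0 \<le> r i" "r i \<le> 1" for i unfolding r_def using slab_depth_range[OF s] by auto
  define J' where "J' = {i \<in> J. p i \<in> cbox 0 (slab_corner k\<^sub>0 s)}"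
  have J': "finite J'" "J' \<subseteq> J" unfolding J'_def using J by auto
  have "\<exists>k. p i $ k / \<sigma> k = r i" if "i \<in> J'" for i
  proof -
    have "r i = Min (range (\<lambda>k. p i $ k / \<sigma> k))"
      using that by (simp add: r_def slab_depth_def J'_def \<sigma>_def)
    also have "\<dots> \<in> range (\<lambda>k. p i $ k / \<sigma> k)" by (rule Min_in) auto
    finally show ?thesis by (elim rangeE) (intro exI, erule sym)
  qed
  then have "\<exists>\<kappa>. \<forall>i\<in>J'. p i $ \<kappa> i / \<sigma> (\<kappa> i) = r i" by (intro bchoice ballI)
  then obtain \<kappa> where \<kappa>: "\<And>i. i \<in> J' \<Longrightarrow> p i $ \<kappa> i / \<sigma> (\<kappa> i) = r i" by blast
  \<comment> \<open>The cut in direction \<open>k\<close>. The inserted 0 is for coordinates that no point has chosen.\<close>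
  define c where "c k = Max (insert 0 (r ` {i \<in> J'. \<kappa> i = k}))" for k
  have c0: "0 \<le> c k" and c_ge: "i \<in> J' \<Longrightarrow> r i \<le> c (\<kappa> i)" for k i
    unfolding c_def using J' by (auto intro!: Max_ge)
  have c_in: "c k = 0 \<or> (\<exists>i\<in>J'. \<kappa> i = k \<and> c k = r i)" for k
    using Max_in[of "insert 0 (r ` {i \<in> J'. \<kappa> i = k})"] J' unfolding c_def by auto
  have c1: "c k \<le> 1" for k using c_in[of k] r by auto
  have c\<sigma>: "0 \<le> c k * \<sigma> k" for k
    using c0[of k] \<sigma>(1)[of k] by simp
  define B where "B = box (\<chi> k. c k * \<sigma> k) (slab_corner k\<^sub>0 s)"
  have "box_in_unit_cube B"
    unfolding B_def using c\<sigma> slab_corner_bounds(2)[OF s]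
    by (intro box_in_unit_cube_box) auto
  moreover have "B \<inter> p ` J = {}"
  proof -
    have "p i \<notin> B" if "i \<in> J" for i
    proof
      assume B: "p i \<in> B"
      have "p i $ k \<in> {0..slab_corner k\<^sub>0 s $ k}" for k
      proof -
        have "c k * \<sigma> k < p i $ k" "p i $ k < slab_corner k\<^sub>0 s $ k"
          using B by (auto simp: B_def mem_box_cart)
        with c\<sigma>[of k] show ?thesis by auto
      qed
      then have iJ': "i \<in> J'" using that by (auto simp: J'_def mem_box_cart)
      have "c (\<kappa> i) * \<sigma> (\<kappa> i) < p i $ \<kappa> i" using B by (simp add: B_def mem_box_cart)
      also have "p i $ \<kappa> i = r i * \<sigma> (\<kappa> i)"
        unfolding \<kappa>[OF iJ', symmetric] using \<sigma>(1)[of "\<kappa> i"] by simp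
      also have "\<dots> \<le> c (\<kappa> i) * \<sigma> (\<kappa> i)"
        using c_ge[OF iJ'] \<sigma>(1)[of "\<kappa> i"] by (intro mult_right_mono) auto
      finally show False by simp
    qed
    then show ?thesis by auto
  qed
  ultimately have disp: "measure lborel B \<le> dispersion (p ` J)" by (rule dispersion_ge)
  have "(\<Prod>i\<in>J. 1 - r i) = (\<Prod>i\<in>J'. 1 - r i)"
    by (rule prod.mono_neutral_right) (use J J' in \<open>auto simp: J'_def r_def slab_depth_def\<close>)
  also have "\<dots> = (\<Prod>k\<in>UNIV. \<Prod>i\<in>{i \<in> J'. \<kappa> i = k}. 1 - r i)"
    using J'(1) by (intro prod.group[symmetric]) auto
  also have "\<dots> \<le> (\<Prod>k\<in>UNIV. 1 - c k)"
  proof (intro prod_mono conjI)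
    fix k
    show "0 \<le> (\<Prod>i\<in>{i \<in> J'. \<kappa> i = k}. 1 - r i)" using r by (intro prod_nonneg) auto
    from c_in[of k] show "(\<Prod>i\<in>{i \<in> J'. \<kappa> i = k}. 1 - r i) \<le> 1 - c k"
    proof
      assume "c k = 0"
      then show ?thesis using r by (auto intro!: prod_le_1)
    next
      assume "\<exists>i\<in>J'. \<kappa> i = k \<and> c k = r i"
      then obtain i where i: "i \<in> J'" "\<kappa> i = k" "c k = r i" by blast
      have "(\<Prod>i\<in>{i \<in> J'. \<kappa> i = k}. 1 - r i) =
          (1 - r i) * (\<Prod>i\<in>{i \<in> J'. \<kappa> i = k} - {i}. 1 - r i)"
        by (rule prod.remove) (use J' i in auto)
      also have "\<dots> \<le> (1 - r i) * 1"
        using r by (intro mult_left_mono prod_le_1) auto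
      finally show ?thesis using i by simp
    qed
  qed
  finally have "s * (\<Prod>i\<in>J. 1 - r i) \<le> s * (\<Prod>k\<in>UNIV. 1 - c k)"
    using s by (intro mult_left_mono) auto
  also have "\<dots> = (\<Prod>k\<in>UNIV. \<sigma> k * (1 - c k))"
    unfolding prod.distrib by (simp add: \<sigma>_def prod_slab_corner)
  also have "\<dots> = measure lborel B"
    unfolding B_def using c1 \<sigma>
    by (subst lborel_box_cart) (auto simp: \<sigma>_def[symmetric] mult_left_le_one_le c0 less_imp_le algebra_simps)
  finally show ?thesis using disp by (simp add: r_def)
qed

text \<open>The points of depth at least \<open>u\<close> form a scaled copy of the slab. At \<open>u = 0\<close> they would be the whole
  cube instead, because of the value 0 outside the slab.\<close>

lemma volume_slab_depth_ge:
  assumes s: "0 < s" "s \<le> 1" and u: "0 < u"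
  shows "emeasure lborel {x \<in> cbox 0 1. u \<le> slab_depth k\<^sub>0 s (x :: real ^ 'd)} =
    ennreal (s * (1 - u) ^ CARD('d)) * indicator {0..1} u"
proof (cases "u \<le> 1")
  case True
  have eq: "{x \<in> cbox 0 1. u \<le> slab_depth k\<^sub>0 s x} = cbox (u *\<^sub>R slab_corner k\<^sub>0 s) (slab_corner k\<^sub>0 s)" (is "?L = ?R")
  proof (intro set_eqI)
    fix x :: "real ^ 'd"
    have "x \<in> ?L \<longleftrightarrow> x \<in> cbox 0 (slab_corner k\<^sub>0 s) \<and> (\<forall>k. u \<le> x $ k / slab_corner k\<^sub>0 s $ k)"
      using u slab_corner_bounds[OF s, of k\<^sub>0]
      by (auto simp: slab_depth_def mem_box_cart intro: order_trans)
    also have "\<dots> \<longleftrightarrow> x \<in> ?R"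
    proof -
      have "0 \<le> x $ k \<and> x $ k \<le> slab_corner k\<^sub>0 s $ k \<and> u \<le> x $ k / slab_corner k\<^sub>0 s $ k \<longleftrightarrow>
          u * slab_corner k\<^sub>0 s $ k \<le> x $ k \<and> x $ k \<le> slab_corner k\<^sub>0 s $ k" for k
      proof -
        have "0 \<le> u * slab_corner k\<^sub>0 s $ k" using u slab_corner_bounds[OF s, of k\<^sub>0 k] by simp
        then show ?thesis
          using slab_corner_bounds[OF s, of k\<^sub>0 k] by (auto simp: pos_le_divide_eq)
      qed
      then show ?thesis by (auto simp: mem_box_cart)
    qed
    finally show "x \<in> ?L \<longleftrightarrow> x \<in> ?R" .
  qed
  have "emeasure lborel (cbox (u *\<^sub>R slab_corner k\<^sub>0 s) (slab_corner k\<^sub>0 s)) =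
      ennreal (\<Prod>k\<in>(UNIV :: 'd set). slab_corner k\<^sub>0 s $ k * (1 - u))"
  proof (subst lborel_box_cart)
    show "(u *\<^sub>R slab_corner k\<^sub>0 s) $ k \<le> slab_corner k\<^sub>0 s $ k" for k
      using u True slab_corner_bounds[OF s, of k\<^sub>0 k] by (simp add: mult_left_le_one_le less_imp_le)
  qed (simp add: algebra_simps)
  then show ?thesis
    unfolding eq prod.distrib prod_slab_corner using u True by simp
next
  case False
  then have "{x \<in> cbox 0 1. u \<le> slab_depth k\<^sub>0 s x} = {}"
    using slab_depth_range(2)[OF s, of k\<^sub>0] order_trans by blast
  then show ?thesis using False by (simp only: emeasure_empty) simp
qed

text \<open>In the coordinates of the slab, this is the expected minimum of \<open>d\<close> independent uniform variables.
  Integrating the layers \<open>{x. u \<le> slab_depth k\<^sub>0 s x}\<close> over \<open>u\<close> reduces it to the integral of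
  \<open>s * (1 - u) ^ d\<close>.\<close>

lemma nn_integral_slab_depth:
  fixes k\<^sub>0 :: "'d::finite"
  assumes s: "0 < s" "s \<le> 1"
  shows "(\<integral>\<^sup>+x. ennreal (slab_depth k\<^sub>0 s x) \<partial>uniform_measure lborel (cbox 0 1)) =
    ennreal (s / (real CARD('d) + 1))"
proof -
  define d where "d = CARD('d)"
  define Q :: "(real ^ 'd) set" where "Q = cbox 0 1"
  have [measurable]: "Q \<in> sets borel" unfolding Q_def by simp
  have "(\<integral>\<^sup>+x. ennreal (slab_depth k\<^sub>0 s x) \<partial>uniform_measure lborel Q) =
      (\<integral>\<^sup>+x. ennreal (slab_depth k\<^sub>0 s x) * indicator Q x \<partial>lborel)"
    by (subst nn_integral_uniform_measure)
      (auto simp: Q_def emeasure_unit_cube divide_ennreal_def)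
  also have "\<dots> = (\<integral>\<^sup>+x. (\<integral>\<^sup>+u. indicator {0<..slab_depth k\<^sub>0 s x} u * indicator Q x \<partial>lborel) \<partial>lborel)"
    using slab_depth_range(1)[OF s, of k\<^sub>0] by (simp add: nn_integral_multc)
  also have "\<dots> = (\<integral>\<^sup>+u. (\<integral>\<^sup>+x. indicator {0<..slab_depth k\<^sub>0 s x} u * indicator Q x \<partial>lborel) \<partial>lborel)"
  proof (rule lborel_pair.Fubini')
    have "(\<lambda>(u, x). indicator {0<..slab_depth k\<^sub>0 s x} u * indicator Q x :: ennreal) =
        indicator {z :: real \<times> (real ^ 'd). 0 < fst z \<and> fst z \<le> slab_depth k\<^sub>0 s (snd z) \<and> snd z \<in> Q}"
      by (auto simp: fun_eq_iff indicator_def)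
    moreover have "{z :: real \<times> (real ^ 'd). 0 < fst z \<and> fst z \<le> slab_depth k\<^sub>0 s (snd z) \<and> snd z \<in> Q}
        \<in> sets (lborel \<Otimes>\<^sub>M lborel)"
    proof -
      have "Measurable.pred (borel \<Otimes>\<^sub>M borel)
          (\<lambda>z :: real \<times> (real ^ 'd). 0 < fst z \<and> fst z \<le> slab_depth k\<^sub>0 s (snd z) \<and> snd z \<in> Q)"
        by measurable
      then show ?thesis
        by (simp add: pred_def space_pair_measure cong: sets_pair_measure_cong)
    qed
    ultimately show "(\<lambda>(u, x). indicator {0<..slab_depth k\<^sub>0 s x} u * indicator Q x :: ennreal)
        \<in> borel_measurable (lborel \<Otimes>\<^sub>M lborel)"
      by simp
  qed
  also have "\<dots> = (\<integral>\<^sup>+u. ennreal (s * (1 - u) ^ d) * indicator {0..1} u \<partial>lborel)"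
  proof (rule nn_integral_cong_AE, rule AE_mp[OF AE_lborel_singleton[of 0]], rule AE_I2, intro impI)
    fix u :: real assume "u \<noteq> 0"
    show "(\<integral>\<^sup>+x. indicator {0<..slab_depth k\<^sub>0 s x} u * indicator Q x \<partial>lborel) =
        ennreal (s * (1 - u) ^ d) * indicator {0..1} u"
    proof (cases "0 < u")
      case True
      have "(\<integral>\<^sup>+x. indicator {0<..slab_depth k\<^sub>0 s x} u * indicator Q x \<partial>lborel) =
          (\<integral>\<^sup>+x. indicator {x \<in> Q. u \<le> slab_depth k\<^sub>0 s x} x \<partial>lborel)"
        using True by (intro nn_integral_cong) (auto simp: indicator_def)
      also have "\<dots> = emeasure lborel {x \<in> Q. u \<le> slab_depth k\<^sub>0 s x}"
        by (rule nn_integral_indicator) measurable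
      finally show ?thesis using volume_slab_depth_ge[OF s True, of k\<^sub>0] by (simp only: Q_def d_def)
    qed (use \<open>u \<noteq> 0\<close> in auto)
  qed
  also have "\<dots> = ennreal (- (s / real (Suc d)) * (1 - 1) ^ Suc d - (- (s / real (Suc d)) * (1 - 0) ^ Suc d))"
  proof (rule nn_integral_FTC_Icc)
    fix u :: real assume u: "u \<in> {0..1}"
    show "((\<lambda>u. - (s / real (Suc d)) * (1 - u) ^ Suc d) has_real_derivative s * (1 - u) ^ d) (at u)"
      by (auto intro!: derivative_eq_intros simp del: power_Suc of_nat_Suc)
    show "0 \<le> s * (1 - u) ^ d" using u s by simp
  qed auto
  finally show ?thesis by (simp add: Q_def d_def add.commute)
qed

lemma (in uniform_points) expected_dispersion_ge_slab_depth:
  assumes s: "0 < s" "s \<le> 1"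
  shows "s * (1 - s / (real CARD('d) + 1)) ^ n \<le> expected_dispersion M X n"
proof -
  fix k\<^sub>0 :: 'd
  interpret U: prob_space U by (rule prob_space_U)
  have [measurable]: "slab_depth k\<^sub>0 s \<in> borel_measurable U" by simp
  have int: "integrable U (slab_depth k\<^sub>0 s)"
    by (rule U.integrable_const_bound[where B = 1]) (auto simp: slab_depth_range[OF s])
  have "(\<integral>x. slab_depth k\<^sub>0 s x \<partial>U) = s / (real CARD('d) + 1)"
    using s by (intro integral_eq_nn_integral[THEN trans])
      (auto simp: slab_depth_range[OF s] nn_integral_slab_depth)
  then have "(\<integral>x. 1 - slab_depth k\<^sub>0 s x \<partial>U) = 1 - s / (real CARD('d) + 1)"
    using int U.prob_space by simp
  then have E: "expectation (\<lambda>\<omega>. \<Prod>i=1..n. 1 - slab_depth k\<^sub>0 s (X i \<omega>)) =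
      (1 - s / (real CARD('d) + 1)) ^ n"
    using expectation_prod_points[of "\<lambda>x. 1 - slab_depth k\<^sub>0 s x" n] slab_depth_range[OF s, of k\<^sub>0]
    by simp
  have int_prod: "integrable M (\<lambda>\<omega>. \<Prod>i=1..n. 1 - slab_depth k\<^sub>0 s (X i \<omega>))"
    using slab_depth_range[OF s, of k\<^sub>0]
    by (intro integrable_prod_points[of "\<lambda>x. 1 - slab_depth k\<^sub>0 s x"]) auto
  have "s * (1 - s / (real CARD('d) + 1)) ^ n =
      expectation (\<lambda>\<omega>. s * (\<Prod>i=1..n. 1 - slab_depth k\<^sub>0 s (X i \<omega>)))"
    unfolding E[symmetric] by simp
  also have "\<dots> \<le> expectation (disp n)"
    using int_prod by (intro integral_mono integrable_disp dispersion_ge_prod_slab_depth s) auto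
  finally show ?thesis by (simp only: expected_dispersion_def)
qed

section \<open>Numerical estimates for the inverse of the expected dispersion\<close>

lemma exp_minus_one_le_power:
  fixes n :: nat
  shows "exp (- 1) \<le> (1 - 1 / (real n + 1)) ^ n"
proof (cases "n = 0")
  case False
  then have "exp (- (1 / real n)) \<le> 1 - 1 / (real n + 1)"
    using exp_minus_le_one_minus_inverse[of "real n + 1"] by simp
  then have "exp (- (1 / real n)) ^ n \<le> (1 - 1 / (real n + 1)) ^ n"
    by (rule power_mono) simp
  moreover have "exp (- (1 / real n)) ^ n = exp (- 1 :: real)"
    unfolding exp_of_nat_mult[symmetric] using False by simp
  ultimately show ?thesis by simp
qed simp

text \<open>With \<open>u = ln (1 / t)\<close>, the number of boxes is at most \<open>exp (d * (6 + 3 * u))\<close>, because a factor \<open>u\<close>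
  is dominated by \<open>exp (u / 2)\<close>. The lower bound on \<open>n\<close> gives at least \<open>9 / 2 * d * (u + 2)\<close> in the
  exponent of the probability, by \<open>exp 1 \<le> 3\<close>. The difference leaves a factor
  \<open>exp (- u)\<close>, which is \<open>t\<close>.\<close>

lemma union_bound_small:
  fixes t d n :: real and k :: nat
  assumes t: "0 < t" "t \<le> exp (- 2)" and d: "1 \<le> d" and k: "real k = 2 * d"
    and n: "9 * (1 + exp (- 1)) * (d / (2 * t)) * ln (9 * (exp 1 + 1) / (2 * t)) \<le> n"
  shows "(exp 1 * (4 * ln (1 / t) / t + 2)) ^ k * exp (- (3 / 4 * t * n)) \<le> t"
proof -
  define u where "u = ln (1 / t)"
  have exp_u: "exp u = 1 / t" unfolding u_def using t by simp
  have "ln t \<le> - 2" using t by (metis exp_gt_zero ln_exp ln_le_cancel_iff)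
  then have u: "2 \<le> u" unfolding u_def using t by (simp add: ln_div)
  have "u \<le> exp (u / 2)"
  proof -
    have "0 \<le> (u - 2)\<^sup>2" by simp
    then have "u \<le> 1 + u / 2 + (u / 2)\<^sup>2 / 2" by (simp add: power2_eq_square field_simps)
    also have "\<dots> \<le> exp (u / 2)" using u by (intro exp_lower_Taylor_quadratic) simp
    finally show ?thesis .
  qed
  moreover have "5 \<le> exp (2 :: real)" using exp_lower_Taylor_quadratic[of 2] by simp
  ultimately have "exp 1 * (5 * u * exp u) \<le> exp 1 * (exp 2 * exp (u / 2) * exp u)"
    using u by (intro mult_left_mono mult_right_mono mult_mono) auto
  moreover have "4 * ln (1 / t) / t + 2 \<le> 5 * u * exp u"
  proof -
    have "2 * 1 \<le> u * exp u" using u by (intro mult_mono) auto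
    moreover have "4 * ln (1 / t) / t = 4 * (u * exp u)" unfolding exp_u by (simp add: u_def)
    ultimately show ?thesis by simp
  qed
  ultimately have "exp 1 * (4 * ln (1 / t) / t + 2) \<le> exp 1 * (exp 2 * exp (u / 2) * exp u)"
    by (meson exp_ge_zero mult_left_mono order_trans)
  also have "\<dots> = exp (3 + 3 / 2 * u)" by (simp add: field_simps flip: exp_add)
  finally have base: "exp 1 * (4 * ln (1 / t) / t + 2) \<le> exp (3 + 3 / 2 * u)" .
  have "0 \<le> 4 * u / t" using u t by simp
  then have "0 \<le> exp 1 * (4 * ln (1 / t) / t + 2)"
    unfolding u_def by (intro mult_nonneg_nonneg add_nonneg_nonneg) auto
  with base have "(exp 1 * (4 * ln (1 / t) / t + 2)) ^ k \<le> exp (3 + 3 / 2 * u) ^ k"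
    by (rule power_mono)
  also have "\<dots> = exp (d * (6 + 3 * u))"
    unfolding exp_of_nat_mult[symmetric] k by (simp add: algebra_simps)
  finally have card: "(exp 1 * (4 * ln (1 / t) / t + 2)) ^ k \<le> exp (d * (6 + 3 * u))" .
  have e: "exp 1 \<le> (3 :: real)" by (rule exp_le)
  have "9 / 2 * (d * (u + 2)) \<le> 3 / 4 * t * n"
  proof -
    define L where "L = ln (9 * (exp 1 + 1) / (2 * t))"
    have "exp (2 :: real) = exp 1 * exp 1" by (simp flip: exp_add)
    also have "\<dots> \<le> 3 * exp 1" using e by (intro mult_right_mono) auto
    also have "\<dots> \<le> 9 * (exp 1 + 1) / 2" by simp
    finally have "exp (2 :: real) * exp u \<le> 9 * (exp 1 + 1) / 2 * exp u"
      by (rule mult_right_mono) simp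
    then have "exp (u + 2) \<le> 9 * (exp 1 + 1) / (2 * t)" by (simp add: exp_u exp_add mult.commute)
    then have L: "u + 2 \<le> L" unfolding L_def using t by (subst ln_ge_iff) (auto simp: add_pos_pos)
    have "1 / 3 \<le> 1 / exp (1 :: real)" using e by (intro divide_left_mono) auto
    then have "4 / 3 \<le> 1 + exp (- 1 :: real)" by (simp add: exp_minus inverse_eq_divide)
    then have "27 / 8 * (4 / 3) * (d * (u + 2)) \<le> 27 / 8 * (1 + exp (- 1)) * (d * L)"
      using L d u by (intro mult_mono mult_left_mono) auto
    also have "\<dots> = 3 / 4 * t * (9 * (1 + exp (- 1)) * (d / (2 * t)) * L)"
      using t by (simp add: field_simps)
    also have "\<dots> \<le> 3 / 4 * t * n" using n t unfolding L_def by (intro mult_left_mono) auto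
    finally show ?thesis by simp
  qed
  moreover have "u \<le> d * u" using d u by simp
  moreover have "d * (6 + 3 * u) = 9 / 2 * (d * (u + 2)) - 3 * d - 3 / 2 * (d * u)"
    by (simp add: algebra_simps)
  ultimately have "d * (6 + 3 * u) + - (3 / 4 * t * n) \<le> - u"
    using d u by linarith
  then have "exp (d * (6 + 3 * u) + - (3 / 4 * t * n)) \<le> exp (- u)" by simp
  then have "exp (d * (6 + 3 * u)) * exp (- (3 / 4 * t * n)) \<le> t"
    by (simp only: exp_add) (simp add: exp_minus[of u] exp_u)
  moreover have "(exp 1 * (4 * ln (1 / t) / t + 2)) ^ k * exp (- (3 / 4 * t * n)) \<le>
      exp (d * (6 + 3 * u)) * exp (- (3 / 4 * t * n))"
    using card by (rule mult_right_mono) simp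
  ultimately show ?thesis by linarith
qed

context uniform_points
begin

text \<open>The value \<open>\<epsilon>\<close> is split evenly between the threshold \<open>t\<close> of the union bound and the expected
  number of empty boxes.\<close>

lemma expected_dispersion_le:
  assumes \<epsilon>: "0 < \<epsilon>" "\<epsilon> < 1 / (9 * exp 1)"
    and n: "9 * (1 + exp (- 1)) * (real CARD('d) / \<epsilon>) * ln (9 * (exp 1 + 1) / \<epsilon>) \<le> real n"
  shows "expected_dispersion M X n \<le> \<epsilon>"
proof -
  define t where "t = \<epsilon> / 2"
  have "exp (2 :: real) = exp 1 * exp 1" by (simp flip: exp_add)
  also have "\<dots> \<le> 18 * exp 1" using exp_le by (intro mult_right_mono) auto
  finally have "1 / (18 * exp 1) \<le> 1 / exp (2 :: real)" by (intro divide_left_mono) auto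
  then have "t \<le> exp (- 2)" unfolding t_def using \<epsilon> by (simp add: exp_minus inverse_eq_divide)
  moreover have "0 < t" unfolding t_def using \<epsilon> by simp
  ultimately have t: "0 < t" "t \<le> exp (- 2)" "t < 1"
    by (auto intro: le_less_trans)
  have "expected_dispersion M X n \<le>
      t + (exp 1 * (4 * ln (1 / t) / t + 2)) ^ (2 * CARD('d)) * exp (- (3 / 4 * t * real n))"
    using t by (intro expected_dispersion_le_union_bound) auto
  also have "\<dots> \<le> t + t"
    using t n by (intro add_left_mono union_bound_small[where d = "real CARD('d)"])
      (auto simp: t_def Suc_leI)
  finally show ?thesis by (simp add: t_def)
qed

text \<open>With about \<open>y = 1 / (9 * \<epsilon>)\<close> slabs and fewer than \<open>y * ln y\<close> points, the expected number of empty
  slabs is at least 1. Then the expected dispersion is at least half the volume of a slab.\<close>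

lemma expected_dispersion_gt_log:
  assumes \<epsilon>: "0 < \<epsilon>" "\<epsilon> < 1 / (9 * exp 1)"
    and n: "real n < 1 / (9 * \<epsilon>) * ln (1 / (9 * \<epsilon>))"
  shows "\<epsilon> < expected_dispersion M X n"
proof -
  define y where "y = 1 / (9 * \<epsilon>)"
  have "exp 1 < y" unfolding y_def using \<epsilon> by (simp add: field_simps)
  then have y: "2 < y" using exp_ge_add_one_self[of 1] by linarith
  \<comment> \<open>One slab more than the rounded \<open>y\<close>, since the power of \<open>1 - 1 / m\<close> is compared with
    the exponential at \<open>m - 1\<close>.\<close>
  define m where "m = Suc (nat \<lceil>y\<rceil>)"
  have m: "y \<le> real m - 1" "real m \<le> y + 2"
    unfolding m_def using y by linarith+
  then have m2: "2 \<le> m" "2 < real m" using y by linarith+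
  define x where "x = real m * (1 - 1 / real m) ^ n"
  have "1 \<le> x"
  proof -
    have "real n \<le> y * ln y" using n by (simp add: y_def)
    also have "\<dots> \<le> (real m - 1) * ln (real m - 1)"
      using m(1) y by (intro mult_mono) auto
    finally have "real n / (real m - 1) \<le> ln (real m - 1)"
      using m2 by (simp add: pos_divide_le_eq mult.commute)
    then have "exp (- ln (real m - 1)) \<le> exp (real n * - (1 / (real m - 1)))" by simp
    also have "\<dots> = exp (- (1 / (real m - 1))) ^ n" by (rule exp_of_nat_mult)
    also have "\<dots> \<le> (1 - 1 / real m) ^ n"
      using m2 by (intro power_mono exp_minus_le_one_minus_inverse) auto
    finally have "inverse (real m - 1) \<le> (1 - 1 / real m) ^ n"
      using m2 by (simp add: exp_minus)
    moreover have "1 / real m \<le> inverse (real m - 1)"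
      using m2 by (simp add: inverse_eq_divide frac_le)
    ultimately have "1 / real m \<le> (1 - 1 / real m) ^ n" by linarith
    then have "real m * (1 / real m) \<le> x" unfolding x_def by (rule mult_left_mono) simp
    then show ?thesis using m2 by simp
  qed
  then have "1 / 2 \<le> x / (1 + x)" by (simp add: field_simps)
  then have "1 / 2 / real m \<le> x / (1 + x) / real m" by (rule divide_right_mono) simp
  also have "\<dots> \<le> expected_dispersion M X n"
    unfolding x_def by (rule expected_dispersion_ge_empty_slab[OF m2(1)])
  finally have "1 / 2 / real m \<le> expected_dispersion M X n" .
  moreover have "1 / (9 * y) < 1 / (2 * real m)"
    using m y by (intro divide_strict_left_mono) auto
  moreover have "1 / (9 * y) = \<epsilon>" using \<epsilon> by (simp add: y_def)
  ultimately show ?thesis by simp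
qed

text \<open>For \<open>n\<close> points the best width of the slab is about \<open>(d + 1) / (n + 1)\<close>: a slab that contains about
  \<open>d\<close> points, each of which costs a proportion \<open>1 / (d + 1)\<close>, keeps a proportion of about \<open>exp (- 1)\<close>
  of its volume. If there are fewer than \<open>d\<close> points, the whole cube serves as the slab.\<close>

lemma expected_dispersion_gt_dimension:
  assumes \<epsilon>: "0 < \<epsilon>" "\<epsilon> < 1 / (9 * exp 1)"
    and n: "1 \<le> n" "real n < real CARD('d) / (2 * exp 1 * \<epsilon>)"
  shows "\<epsilon> < expected_dispersion M X n"
proof -
  define d where "d = CARD('d)"
  have d: "1 \<le> d" by (simp add: d_def Suc_leI)
  show ?thesis
  proof (cases "d \<le> n")
    case True
    define s where "s = (real d + 1) / (real n + 1)"
    have s: "0 < s" "s \<le> 1" "s / (real d + 1) = 1 / (real n + 1)"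
      unfolding s_def using True by auto
    have "\<epsilon> < real d / (2 * real n) * exp (- 1)"
      using n \<epsilon> by (simp add: d_def exp_minus field_simps)
    also have "\<dots> \<le> s * exp (- 1)"
    proof (rule mult_right_mono)
      have "real d * (real n + 1) \<le> real d * (2 * real n)" using n by (intro mult_left_mono) auto
      also have "\<dots> \<le> (real d + 1) * (2 * real n)" by (intro mult_right_mono) auto
      finally show "real d / (2 * real n) \<le> s"
        unfolding s_def using n by (simp add: divide_le_eq field_simps)
    qed simp
    also have "\<dots> \<le> s * (1 - s / (real d + 1)) ^ n"
      unfolding s(3) using s(1) by (intro mult_left_mono exp_minus_one_le_power) auto
    also have "\<dots> \<le> expected_dispersion M X n"
      unfolding d_def using s by (intro expected_dispersion_ge_slab_depth) auto
    finally show ?thesis .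
  next
    case False
    have "\<epsilon> < 1 / (9 * exp 1)" by (rule \<epsilon>)
    also have "\<dots> \<le> exp (- 1)" by (simp add: exp_minus field_simps)
    also have "\<dots> \<le> (1 - 1 / (real d + 1)) ^ d" by (rule exp_minus_one_le_power)
    also have "\<dots> \<le> (1 - 1 / (real d + 1)) ^ n"
      using False by (intro power_decreasing) auto
    also have "\<dots> \<le> expected_dispersion M X n"
      using expected_dispersion_ge_slab_depth[of 1 n] by (simp add: d_def)
    finally show ?thesis .
  qed
qed

end

theorem corollary1p2:
  fixes M :: "'a measure"
    and X :: "nat \<Rightarrow> 'a \<Rightarrow> real ^ 'd"
    and \<epsilon> :: real
  assumes "prob_space M"
    and "iid_uniform_unit_cube M X"
    and "0 < \<epsilon>" and "\<epsilon> < 1 / (9 * exp 1)"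
  shows "max (1 / (9 * \<epsilon>) * ln (1 / (9 * \<epsilon>))) (real CARD('d) / (2 * exp 1 * \<epsilon>))
           \<le> real (inverse_expected_dispersion M X \<epsilon>)
       \<and> int (inverse_expected_dispersion M X \<epsilon>)
           \<le> \<lceil>9 * (1 + exp (- 1)) * (real CARD('d) / \<epsilon>) * ln (9 * (exp 1 + 1) / \<epsilon>)\<rceil>"
proof -
  interpret prob_space M by (rule assms(1))
  interpret uniform_points M X by unfold_locales (rule assms(2))
  define N where "N = inverse_expected_dispersion M X \<epsilon>"
  define R where "R = 9 * (1 + exp (- 1)) * (real CARD('d) / \<epsilon>) * ln (9 * (exp 1 + 1) / \<epsilon>)"
  have "\<epsilon> < 1"
  proof -
    have "1 / (9 * exp 1) \<le> (1 :: real)" using exp_ge_add_one_self[of 1] by (simp add: field_simps)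
    with assms(4) show ?thesis by linarith
  qed
  then have "1 < 9 * (exp 1 + 1) / \<epsilon>"
    using assms(3) exp_ge_add_one_self[of "1 :: real"] by (simp add: pos_less_divide_eq)
  then have R: "0 < R"
    unfolding R_def using assms(3) by (intro mult_pos_pos divide_pos_pos ln_gt_zero add_pos_pos) auto
  define n\<^sub>0 where "n\<^sub>0 = nat \<lceil>R\<rceil>"
  have n\<^sub>0: "1 \<le> n\<^sub>0" "R \<le> real n\<^sub>0" "int n\<^sub>0 = \<lceil>R\<rceil>"
    unfolding n\<^sub>0_def using R by linarith+
  have "expected_dispersion M X n\<^sub>0 \<le> \<epsilon>"
    using assms(3,4) n\<^sub>0(2) unfolding R_def by (rule expected_dispersion_le)
  with n\<^sub>0(1) have witness: "1 \<le> n\<^sub>0 \<and> expected_dispersion M X n\<^sub>0 \<le> \<epsilon>" by simp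
  have upper: "N \<le> n\<^sub>0"
    unfolding N_def inverse_expected_dispersion_def using witness by (rule Least_le)
  have N: "1 \<le> N" "expected_dispersion M X N \<le> \<epsilon>"
    using LeastI[of "\<lambda>n. 1 \<le> n \<and> expected_dispersion M X n \<le> \<epsilon>", OF witness]
    unfolding N_def inverse_expected_dispersion_def by auto
  have "1 / (9 * \<epsilon>) * ln (1 / (9 * \<epsilon>)) \<le> real N"
    using expected_dispersion_gt_log[OF assms(3,4), of N] N(2) by linarith
  moreover have "real CARD('d) / (2 * exp 1 * \<epsilon>) \<le> real N"
    using expected_dispersion_gt_dimension[OF assms(3,4) N(1)] N(2) by linarith
  moreover have "int N \<le> \<lceil>R\<rceil>"
    unfolding n\<^sub>0(3)[symmetric] using upper by simp
  ultimately show ?thesis by (simp add: N_def R_def)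
qed

end
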